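(* Let $X$ and $Y$ be normed linear spaces over $\mathbb{R}$ and let $f : X \to Y$ be a uniformly continuous function on $X$. Then there exist real numbers $a, b > 0$ such that $\|f(x)\| \leq a\|x\| + b$ for all $x \in X$.
   Context: The norms of $X$ and $Y$ are both denoted $\|\cdot\|$. The function $f$ is not assumed to be linear. Uniform continuity is with respect to the metrics induced by the norms. *)

theory Defs
  imports Complex_Main
begin

end

theory Submission
  imports Defs
begin

text \<open>Uniform continuity with tolerance 1 gives \<open>d > 0\<close> such that any move
  shorter than \<open>d\<close> changes \<open>f\<close> by at most 1. The segment from 0 to
  \<open>x\<close> splits into \<open>n\<close> equal moves shorter than \<open>d\<close>, with
  \<open>n\<close> at most \<open>norm x / d + 1\<close>. Summing the changes along this chain,
  which is what \<open>dist_scaleR_of_nat_le\<close> does, bounds \<open>norm (f x - f 0)\<close> by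
  \<open>n\<close>, so \<open>a = 1 / d\<close> and \<open>b = norm (f 0) + 1\<close> work.\<close>

lemma dist_scaleR_of_nat_le:
  fixes f :: "'a::real_normed_vector \<Rightarrow> 'b::metric_space"
  assumes step: "\<And>x y. dist x y < d \<Longrightarrow> dist (f x) (f y) \<le> e"
    and u: "norm u < d"
  shows "dist (f (real n *\<^sub>R u)) (f 0) \<le> real n * e"
proof (induction n)
  case (Suc n)
  have "dist (f (real (Suc n) *\<^sub>R u)) (f (real n *\<^sub>R u)) \<le> e"
    using u by (intro step) (simp add: dist_norm algebra_simps)
  moreover have "dist (f (real (Suc n) *\<^sub>R u)) (f 0)
      \<le> dist (f (real (Suc n) *\<^sub>R u)) (f (real n *\<^sub>R u)) + dist (f (real n *\<^sub>R u)) (f 0)"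
    by (rule dist_triangle)
  moreover have "real (Suc n) * e = e + real n * e"
    by (simp add: algebra_simps)
  ultimately show ?case
    using Suc.IH by linarith
qed simp

theorem theorem2p1:
  fixes f :: "'a::real_normed_vector \<Rightarrow> 'b::real_normed_vector"
  assumes "uniformly_continuous_on UNIV f"
  shows "\<exists>a b :: real. a > 0 \<and> b > 0 \<and> (\<forall>x. norm (f x) \<le> a * norm x + b)"
proof -
  obtain d where "d > 0" and step: "\<And>x y. dist x y < d \<Longrightarrow> dist (f x) (f y) \<le> 1"
    using assms unfolding uniformly_continuous_on_def
    by (metis UNIV_I less_imp_le zero_less_one)
  have "norm (f x) \<le> 1 / d * norm x + (norm (f 0) + 1)" for x
  proof -
    \<comment> \<open>The successor of the floor, rather than the ceiling, makes
      \<open>norm x / d < real n\<close> strict, as the strict bound in \<open>step\<close>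
      requires, and keeps \<open>n\<close> positive even for \<open>x = 0\<close>.\<close>
    define n where "n = Suc (nat \<lfloor>norm x / d\<rfloor>)"
    have "norm x / d \<ge> 0"
      using \<open>d > 0\<close> by simp
    then have n: "norm x / d < real n" "real n \<le> norm x / d + 1" "n > 0"
      unfolding n_def by linarith+
    have "norm (x /\<^sub>R real n) < d"
      using n \<open>d > 0\<close> by (simp add: field_simps)
    \<comment> \<open>With \<open>u = x /\<^sub>R real n\<close>, the endpoint
      \<open>real n *\<^sub>R u\<close> of the chain is \<open>x\<close> itself, since
      \<open>n > 0\<close>.\<close>
    from dist_scaleR_of_nat_le[of d f 1, OF step this, of n]
    have "norm (f x - f 0) \<le> real n"
      using n by (simp add: dist_norm)
    then show ?thesis
      using n norm_triangle_sub[of "f x" "f 0"] by simp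
  qed
  moreover have "1 / d > 0" "norm (f 0) + 1 > 0"
    using \<open>d > 0\<close> by (simp_all add: add_nonneg_pos)
  ultimately show ?thesis
    by blast
qed

end
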